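(* Let $(X,d)$ be a compact metric space, $\mathcal{A}$ a finite set of characters, $\{f_j : j\in\mathcal{A}\}$ continuous self-maps of $X$, and $t=t_1t_2\cdots\in\mathcal{A}^{\mathbb{N}}$. Let $\mathbf{F}^+_t=\{f_{t_i,\infty} : i\in\mathbb{N}\}\subseteq\mathbf{N}$ be the shifted family of $f_{t_1,\infty}$. Then, with closure taken in $(\mathbf{N},\rho)$, $$\overline{\mathbf{F}^+_t}=\{f_{\sigma_1,\infty} : \sigma=\sigma_1\sigma_2\cdots\in\overline{\mathcal{O}^+(t)}\}.$$
   Context: For $\sigma=\sigma_1\sigma_2\cdots\in\mathcal{A}^{\mathbb{N}}$ and $n\ge 1$ write $f_{\sigma_1\cdots\sigma_n}=f_{\sigma_n}\circ\cdots\circ f_{\sigma_1}$. The non-autonomous system (NDS) along $\sigma$ is $f_{\sigma_1,\infty}=\cdots\circ f_{\sigma_2}\circ f_{\sigma_1}$, and $f_{\sigma_i,\infty}=\cdots\circ f_{\sigma_{i+1}}\circ f_{\sigma_i}$ is its $i$-th shifted NDS, i.e. the NDS along $\sigma_i\sigma_{i+1}\cdots$. $\mathbf{N}$ is the set of all NDS's $f_{\sigma_1,\infty}$, $\sigma\in\mathcal{A}^{\mathbb{N}}$; an NDS is identified with its sequence of partial compositions $(f_{\sigma_1\cdots\sigma_n})_{n\ge1}$. $\mathbf{N}$ carries the metric $$\rho(f_{\sigma_1,\infty},f_{\sigma'_1,\infty})=\sum_{n\in\mathbb{N}}\frac{D(f_{\sigma_1\cdots\sigma_n},f_{\sigma'_1\cdots\sigma'_n})}{2^{n-1}},\qquad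 D(f,g)=\sup_{x\in X}d(f(x),g(x)).$$ $\tau:\mathcal{A}^{\mathbb{N}}\to\mathcal{A}^{\mathbb{N}}$ is the shift map, $\tau(\sigma)_i=\sigma_{i+1}$; $\mathcal{O}^+(t)=\{\tau^i(t) : i\in\mathbb{N}\cup\{0\}\}$, and $\overline{\mathcal{O}^+(t)}$ is its closure in $\mathcal{A}^{\mathbb{N}}$ with the product of discrete topologies. *)

theory Defs
  imports "HOL-Analysis.Analysis"
begin

text \<open>
  The alphabet is a finite type \<open>'a\<close> and the compact metric space is a type \<open>'x\<close> whose universe is
  compact. Sequences are indexed from 0: \<open>\<sigma> n\<close> stands for \<open>\<sigma>\<close> with subscript \<open>n + 1\<close> in the usual
  one-based notation, and likewise position \<open>n\<close> of an NDS holds the composition of the first \<open>n + 1\<close> maps.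
\<close>

primrec partial_comp :: "('a \<Rightarrow> 'x \<Rightarrow> 'x) \<Rightarrow> (nat \<Rightarrow> 'a) \<Rightarrow> nat \<Rightarrow> 'x \<Rightarrow> 'x" where
  "partial_comp f \<sigma> 0 = f (\<sigma> 0)"
| "partial_comp f \<sigma> (Suc n) = f (\<sigma> (Suc n)) \<circ> partial_comp f \<sigma> n"

text \<open>An NDS is identified with its sequence of partial compositions, so distinct symbol sequences
  may give the same NDS.\<close>

definition nds :: "('a \<Rightarrow> 'x \<Rightarrow> 'x) \<Rightarrow> (nat \<Rightarrow> 'a) \<Rightarrow> nat \<Rightarrow> 'x \<Rightarrow> 'x" where
  "nds f \<sigma> = (\<lambda>n. partial_comp f \<sigma> n)"

definition shifted_nds :: "('a \<Rightarrow> 'x \<Rightarrow> 'x) \<Rightarrow> (nat \<Rightarrow> 'a) \<Rightarrow> nat \<Rightarrow> nat \<Rightarrow> 'x \<Rightarrow> 'x" where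
  "shifted_nds f \<sigma> i = nds f (\<lambda>n. \<sigma> (i + n))"

definition all_nds :: "('a \<Rightarrow> 'x \<Rightarrow> 'x) \<Rightarrow> (nat \<Rightarrow> 'x \<Rightarrow> 'x) set" where
  "all_nds f = {nds f \<sigma> | \<sigma>. True}"

definition shifted_family :: "('a \<Rightarrow> 'x \<Rightarrow> 'x) \<Rightarrow> (nat \<Rightarrow> 'a) \<Rightarrow> (nat \<Rightarrow> 'x \<Rightarrow> 'x) set" where
  "shifted_family f t = {shifted_nds f t i | i. True}"

definition sup_dist :: "('x \<Rightarrow> 'x) \<Rightarrow> ('x \<Rightarrow> 'x::metric_space) \<Rightarrow> real" where
  "sup_dist g h = (SUP x. dist (g x) (h x))"

text \<open>With zero-based indices the weight \<open>1 / 2 ^ (n - 1)\<close> becomes \<open>1 / 2 ^ n\<close>.\<close>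

definition nds_dist :: "(nat \<Rightarrow> 'x \<Rightarrow> 'x) \<Rightarrow> (nat \<Rightarrow> 'x \<Rightarrow> 'x::metric_space) \<Rightarrow> real" where
  "nds_dist F G = (\<Sum>n. sup_dist (F n) (G n) / 2 ^ n)"

definition nds_topology :: "('a \<Rightarrow> 'x \<Rightarrow> 'x::metric_space) \<Rightarrow> (nat \<Rightarrow> 'x \<Rightarrow> 'x) topology" where
  "nds_topology f = Metric_space.mtopology (all_nds f) nds_dist"

definition seq_topology :: "(nat \<Rightarrow> 'a) topology" where
  "seq_topology = product_topology (\<lambda>_. discrete_topology UNIV) UNIV"

definition shift :: "(nat \<Rightarrow> 'a) \<Rightarrow> nat \<Rightarrow> 'a" where
  "shift \<sigma> = (\<lambda>n. \<sigma> (Suc n))"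

definition forward_orbit :: "(nat \<Rightarrow> 'a) \<Rightarrow> (nat \<Rightarrow> 'a) set" where
  "forward_orbit t = {(shift ^^ i) t | i. True}"

text \<open>\<open>Metric_space.mtopology\<close> is a total function, meaningful only for an actual metric; the
  following shows that it is one here.\<close>

lemma bdd_above_dist:
  assumes "compact (UNIV :: 'x::metric_space set)"
  shows "bdd_above (range (\<lambda>x. dist (g x) (h x :: 'x)))"
proof -
  obtain e where "\<And>x y :: 'x. dist x y \<le> e"
    using compact_imp_bounded[OF assms] unfolding bounded_two_points by auto
  then show ?thesis by (auto simp: bdd_above_def)
qed

lemma sup_dist_upper:
  assumes "compact (UNIV :: 'x::metric_space set)"
  shows "dist (g x) (h x :: 'x) \<le> sup_dist g h"
  unfolding sup_dist_def by (rule cSUP_upper[OF _ bdd_above_dist[OF assms]]) simp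

lemma sup_dist_nonneg:
  assumes "compact (UNIV :: 'x::metric_space set)"
  shows "0 \<le> sup_dist g (h :: 'x \<Rightarrow> 'x)"
  using order_trans[OF zero_le_dist sup_dist_upper[OF assms]] .

lemma sup_dist_triangle:
  assumes "compact (UNIV :: 'x::metric_space set)"
  shows "sup_dist g (k :: 'x \<Rightarrow> 'x) \<le> sup_dist g h + sup_dist h k"
proof -
  have "dist (g x) (k x) \<le> sup_dist g h + sup_dist h k" for x
    using dist_triangle[of "g x" "k x" "h x"]
      sup_dist_upper[OF assms, of g x h] sup_dist_upper[OF assms, of h x k] by linarith
  then show ?thesis
    unfolding sup_dist_def[of g k] by (intro cSUP_least) auto
qed

lemma summable_nds_dist:
  assumes "compact (UNIV :: 'x::metric_space set)"
  shows "summable (\<lambda>n. sup_dist (F n) (G n :: 'x \<Rightarrow> 'x) / 2 ^ n)"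
proof -
  obtain e where e: "\<And>x y :: 'x. dist x y \<le> e"
    using compact_imp_bounded[OF assms] unfolding bounded_two_points by auto
  have le: "sup_dist g h \<le> e" for g h :: "'x \<Rightarrow> 'x"
    unfolding sup_dist_def by (intro cSUP_least) (auto simp: e)
  have bound: "norm (sup_dist (F n) (G n) / 2 ^ n) \<le> e * (1 / 2) ^ n" for n
  proof -
    have "norm (sup_dist (F n) (G n) / 2 ^ n) = sup_dist (F n) (G n) / 2 ^ n"
      using sup_dist_nonneg[OF assms, of "F n" "G n"] by simp
    also have "\<dots> \<le> e / 2 ^ n"
      by (intro divide_right_mono le) simp
    finally show ?thesis
      by (simp add: power_divide)
  qed
  have "summable (\<lambda>n. e * (1 / 2 :: real) ^ n)"
    by (intro summable_mult summable_geometric) auto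
  from this bound show ?thesis
    by (rule summable_comparison_test'[where N = 0])
qed

lemma Metric_space_all_nds:
  fixes f :: "'a \<Rightarrow> 'x \<Rightarrow> 'x::metric_space"
  assumes c: "compact (UNIV :: 'x set)"
  shows "Metric_space (all_nds f) nds_dist"
proof
  fix F G :: "nat \<Rightarrow> 'x \<Rightarrow> 'x"
  show "0 \<le> nds_dist F G"
    unfolding nds_dist_def
    by (intro suminf_nonneg summable_nds_dist[OF c]) (simp add: sup_dist_nonneg[OF c])
  show "nds_dist F G = nds_dist G F"
    by (simp add: nds_dist_def sup_dist_def dist_commute)
  show "nds_dist F G = 0 \<longleftrightarrow> F = G"
  proof
    assume "nds_dist F G = 0"
    then have "sup_dist (F n) (G n) / 2 ^ n = 0" for n
      unfolding nds_dist_def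
      by (subst (asm) suminf_eq_zero_iff[OF summable_nds_dist[OF c]])
        (auto simp: sup_dist_nonneg[OF c])
    then have "dist (F n x) (G n x) \<le> 0" for n x
      using sup_dist_upper[OF c, of "F n" x "G n"] by simp
    then show "F = G" by (intro ext) simp
  qed (simp add: nds_dist_def sup_dist_def)
next
  fix F G H :: "nat \<Rightarrow> 'x \<Rightarrow> 'x"
  have "nds_dist F H \<le> (\<Sum>n. sup_dist (F n) (G n) / 2 ^ n + sup_dist (G n) (H n) / 2 ^ n)"
    unfolding nds_dist_def
    by (intro suminf_le summable_add summable_nds_dist[OF c])
      (simp add: add_divide_distrib[symmetric] divide_right_mono sup_dist_triangle[OF c])
  then show "nds_dist F H \<le> nds_dist F G + nds_dist G H"
    by (simp add: nds_dist_def suminf_add summable_nds_dist[OF c])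
qed

end

theory Submission
  imports Defs
begin

text \<open>
  Sequences that agree on a long initial block have equal initial partial compositions, and the tail
  of the series defining \<open>nds_dist\<close> is uniformly small because the space is bounded. Hence \<open>nds f\<close> is
  a continuous map from the compact sequence space to a Hausdorff space; such a map is closed, so it
  commutes with closures, and it carries the forward orbit of \<open>t\<close> onto the shifted family.
\<close>

lemma partial_comp_cong:
  assumes "\<And>m. m \<le> n \<Longrightarrow> \<sigma> m = \<sigma>' m"
  shows "partial_comp f \<sigma> n = partial_comp f \<sigma>' n"
  using assms by (induction n) auto

lemma funpow_shift: "(shift ^^ i) t = (\<lambda>n. t (i + n))"
  by (induction i) (auto simp: shift_def)

text \<open>With zero-based indices the i-th iterate of the shift and the i-th shifted NDS start at
  the same symbol, so no offset by one appears; \<open>i = 0\<close> gives \<open>t\<close> itself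
  on both sides.\<close>

lemma nds_image_forward_orbit: "nds f ` forward_orbit t = shifted_family f t"
  by (auto simp: forward_orbit_def shifted_family_def shifted_nds_def funpow_shift)

text \<open>The first \<open>N\<close> terms of the series vanish, and a factor
  \<open>1 / 2 ^ N\<close> can be pulled out of all remaining weights. The rest is again a value of
  \<open>nds_dist\<close>, so any uniform bound on \<open>nds_dist\<close> controls it.\<close>

lemma nds_dist_split:
  assumes "compact (UNIV :: 'x::metric_space set)"
    and eq: "\<And>n. n < N \<Longrightarrow> F n = (G n :: 'x \<Rightarrow> 'x)"
  shows "nds_dist F G = nds_dist (\<lambda>n. F (n + N)) (\<lambda>n. G (n + N)) / 2 ^ N"
proof -
  have "nds_dist F G = (\<Sum>n. sup_dist (F (n + N)) (G (n + N)) / 2 ^ (n + N))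
      + (\<Sum>n<N. sup_dist (F n) (G n) / 2 ^ n)"
    unfolding nds_dist_def by (rule suminf_split_initial_segment[OF summable_nds_dist[OF assms(1)]])
  \<comment> \<open>For equal maps \<open>sup_dist\<close> is the supremum of the constant 0 over a
    nonempty type, hence 0.\<close>
  also have "(\<Sum>n<N. sup_dist (F n) (G n) / 2 ^ n) = 0"
    by (simp add: eq sup_dist_def)
  also have "(\<Sum>n. sup_dist (F (n + N)) (G (n + N)) / 2 ^ (n + N)) =
      (\<Sum>n. sup_dist (F (n + N)) (G (n + N)) / 2 ^ n / 2 ^ N)"
    by (simp add: power_add)
  also have "\<dots> = nds_dist (\<lambda>n. F (n + N)) (\<lambda>n. G (n + N)) / 2 ^ N"
    unfolding nds_dist_def
    by (rule suminf_divide[OF summable_nds_dist[OF assms(1), of "\<lambda>n. F (n + N)" "\<lambda>n. G (n + N)"]])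
  finally show ?thesis by simp
qed

text \<open>If all distances in the space are at most \<open>e\<close>, the series is dominated by a
  geometric one. The bound must not depend on \<open>F\<close> and \<open>G\<close>, since it is
  applied to tails that vary with the symbol sequences.\<close>

lemma nds_dist_bounded:
  assumes c: "compact (UNIV :: 'x::metric_space set)"
  obtains B where "\<And>F G :: nat \<Rightarrow> 'x \<Rightarrow> 'x. nds_dist F G \<le> B"
proof -
  obtain e where e: "\<And>x y :: 'x. dist x y \<le> e"
    using compact_imp_bounded[OF c] unfolding bounded_two_points by auto
  have summable: "summable (\<lambda>n. e * (1 / 2 :: real) ^ n)"
    by (intro summable_mult summable_geometric) auto
  have le: "sup_dist g h \<le> e" for g h :: "'x \<Rightarrow> 'x"
    unfolding sup_dist_def by (intro cSUP_least) (auto simp: e)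
  have "nds_dist F G \<le> (\<Sum>n. e * (1 / 2) ^ n)" for F G :: "nat \<Rightarrow> 'x \<Rightarrow> 'x"
    unfolding nds_dist_def
    by (intro suminf_le summable_nds_dist[OF c] summable)
      (simp add: power_divide divide_right_mono le)
  then show thesis by (rule that)
qed

lemma topspace_seq_topology [simp]: "topspace seq_topology = UNIV"
  by (simp add: seq_topology_def)

text \<open>Tychonoff's theorem; finiteness of the alphabet makes each discrete factor
  compact.\<close>

lemma compact_space_seq_topology: "compact_space (seq_topology :: (nat \<Rightarrow> 'a::finite) topology)"
  by (simp add: seq_topology_def compact_space_product_topology compact_space_discrete_topology)

text \<open>A cylinder is a basic open box: only the first \<open>N\<close> coordinates are
  restricted, each to a singleton, which is open in the discrete topology.\<close>

lemma openin_cylinder: "openin seq_topology {\<sigma>'. \<forall>n<N. \<sigma>' n = \<sigma> n}"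
proof -
  have "{\<sigma>'. \<forall>n<N. \<sigma>' n = \<sigma> n} = (\<Pi>\<^sub>E n\<in>UNIV. if n < N then {\<sigma> n} else UNIV)"
    by (auto simp: PiE_iff) (metis empty_iff insert_iff)
  moreover have "finite {n. (if n < N then {\<sigma> n} else UNIV) \<noteq> UNIV}"
    by (rule finite_subset[of _ "{..<N}"]) auto
  ultimately show ?thesis
    unfolding seq_topology_def by (auto intro!: product_topology_basis)
qed

lemma continuous_map_nds:
  fixes f :: "'a \<Rightarrow> 'x \<Rightarrow> 'x::metric_space"
  assumes c: "compact (UNIV :: 'x set)"
  shows "continuous_map seq_topology (nds_topology f) (nds f)"
proof -
  interpret Metric_space "all_nds f" nds_dist
    by (rule Metric_space_all_nds[OF c])
  obtain B where B: "\<And>F G :: nat \<Rightarrow> 'x \<Rightarrow> 'x. nds_dist F G \<le> B"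
    using nds_dist_bounded[OF c] by blast
  have all: "nds f \<sigma> \<in> all_nds f" for \<sigma>
    by (auto simp: all_nds_def)
  have "\<exists>U. openin seq_topology U \<and> \<sigma> \<in> U \<and> (\<forall>\<sigma>'\<in>U. nds f \<sigma>' \<in> mball (nds f \<sigma>) \<epsilon>)"
    if "\<epsilon> > 0" for \<sigma> \<epsilon>
  proof -
    \<comment> \<open>The block length \<open>N\<close> is chosen to push the tail bound from
      \<open>nds_dist_split\<close> below \<epsilon>; the cylinder of that length around \<sigma> is
      the required neighbourhood.\<close>
    have "(\<lambda>N. B / 2 ^ N) \<longlonglongrightarrow> 0"
      using tendsto_mult_right_zero[OF LIMSEQ_realpow_zero[of "1/2"], of B]
      by (simp add: power_divide)
    then have "\<forall>\<^sub>F N in sequentially. B / 2 ^ N < \<epsilon>"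
      using that by (rule order_tendstoD)
    then obtain N where N: "B / 2 ^ N < \<epsilon>"
      by (auto simp: eventually_sequentially)
    have "nds_dist (nds f \<sigma>) (nds f \<sigma>') < \<epsilon>" if "\<forall>n<N. \<sigma>' n = \<sigma> n" for \<sigma>'
    proof -
      have "nds f \<sigma> n = nds f \<sigma>' n" if "n < N" for n
        unfolding nds_def using that \<open>\<forall>n<N. \<sigma>' n = \<sigma> n\<close> by (intro partial_comp_cong) auto
      then have "nds_dist (nds f \<sigma>) (nds f \<sigma>') =
          nds_dist (\<lambda>n. nds f \<sigma> (n + N)) (\<lambda>n. nds f \<sigma>' (n + N)) / 2 ^ N"
        by (rule nds_dist_split[OF c])
      also have "\<dots> \<le> B / 2 ^ N"
        by (intro divide_right_mono B) simp
      finally have "nds_dist (nds f \<sigma>) (nds f \<sigma>') \<le> B / 2 ^ N" .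
      with N show ?thesis by linarith
    qed
    then show ?thesis
      by (intro exI[of _ "{\<sigma>'. \<forall>n<N. \<sigma>' n = \<sigma> n}"]) (auto simp: openin_cylinder in_mball all)
  qed
  then show ?thesis
    unfolding nds_topology_def continuous_map_to_metric by auto
qed

theorem proposition2p1:
  fixes f :: "'a::finite \<Rightarrow> 'x \<Rightarrow> 'x::metric_space"
    and t :: "nat \<Rightarrow> 'a"
  assumes "compact (UNIV :: 'x set)"
    and "\<And>j. continuous_on UNIV (f j)"
  shows "nds_topology f closure_of shifted_family f t =
    {nds f \<sigma> | \<sigma>. \<sigma> \<in> seq_topology closure_of forward_orbit t}"
proof -
  interpret Metric_space "all_nds f" nds_dist
    by (rule Metric_space_all_nds[OF assms(1)])
  have cont: "continuous_map seq_topology (nds_topology f) (nds f)"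
    by (rule continuous_map_nds[OF assms(1)])
  have "closed_map seq_topology (nds_topology f) (nds f)"
    using cont compact_space_seq_topology
    by (rule T1_Spaces.continuous_imp_closed_map)
      (simp add: nds_topology_def Hausdorff_space_mtopology)
  \<comment> \<open>The image of the closure is closed and contains the image of the orbit, hence
    also the closure of that image.\<close>
  then have "nds_topology f closure_of (nds f ` forward_orbit t)
      \<subseteq> nds f ` (seq_topology closure_of forward_orbit t)"
    by (simp add: closed_map_closure_of_image)
  moreover have "nds f ` (seq_topology closure_of forward_orbit t)
      \<subseteq> nds_topology f closure_of (nds f ` forward_orbit t)"
    by (rule continuous_map_image_closure_subset[OF cont])
  ultimately show ?thesis
    by (auto simp: nds_image_forward_orbit)
qed

end
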